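(* Let $p\in(1,\infty)$ and let an iterated graph system be given which, for some $L_*\ge2$, satisfies the $L_*$-uniform scaling property, satisfies the doubling property and is conductively uniform. Then $d_{w,p}\ge p$. Furthermore, $d_{w,p}=p$ if and only if the constant density $\rho\equiv L_*^{-1}$ on $E_1$ is the optimal $\Theta(I_{v,e},I_{u,e})$-admissible density (for the $p$-modulus on $G_1$) for all $e=\{v,u\}\in E_1$.
   Context: Graphs are finite and simple; edges are 2-element sets of vertices. An iterated graph system (IGS) consists of a connected graph $G_1=(V_1,E_1)$ with at least one edge, a nonempty finite set $I$, and for every $e\in E_1$ and $v\in e$ an injective map $\phi_{v,e}:I\to V_1$ whose image $I_{v,e}$ is an independent set of $G_1$, with $I_{v,e}\cap I_{w,e}=\emptyset$ for $e=\{v,w\}$. A path is a sequence $[v_1,\dots,v_k]$ of vertices with $\{v_i,v_{i+1}\}$ an edge for each $i$; $\Theta(A,B)$ is the set of paths from a vertex of $A$ to a vertex of $B$. $L_*$-uniform scaling property: $d_{G_1}(x,y)=L_*$ for all $e=\{v,u\}\in E_1$, $x\in I_{v,e}$, $y\in I_{u,e}$ ($d_{G_1}$ is the path metric). Doubling property: every $z\in I_{v,e}$ ($v\in e\in E_1$) has degree $1$ in $G_1$; its unique neighbour is $\mathfrak n(z)$. A flow from $A$ to $B$ in $G=(V,E)$ is $\mathcal F:V\times V\to\mathbb R$ with $\mathcal F(x,y)=-\mathcal F(y,x)$, $\mathcal F(x,y)=0$ unless $\{x,y\}\in E$, and $\sum_{\{x,y\}\in E}\mathcal F(x,y)=0$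 for each $x\notin A\cup B$; it is a unit flow if $\sum_{x\in A}\sum_{\{x,y\}\in E}\mathcal F(x,y)=1$; its energy is $\mathcal E_q(\mathcal F)=\sum_{e\in E}|\mathcal F(e)|^q$. For $p\in(1,\infty)$ with dual exponent $q$ and $e=\{v,u\}\in E_1$, $\mathcal F_{v,e}$ is the unique $\mathcal E_q$-minimizing unit flow from $I_{v,e}$ to $I_{u,e}$ in $G_1$. A doubling IGS is conductively uniform if for every $p\in(1,\infty)$: for each $a\in I$ the value $\mathcal F_{v,e}(\phi_{v,e}(a),\mathfrak n(\phi_{v,e}(a)))$ is the same for all $v\in e\in E_1$, and $\mathcal E_q(\mathcal F_{v,e})$ is the same for all $v\in e\in E_1$. For a family $\Theta$ of paths in $G=(V,E)$, $\rho:E\to[0,\infty)$ is $\Theta$-admissible if $\sum_{i=1}^{k-1}\rho(\{v_i,v_{i+1}\})\ge1$ for all $[v_1,\dots,v_k]\in\Theta$; $\mathrm{Mod}_p(\Theta,G)=\inf\sum_{e\in E}\rho(e)^p$ over admissible $\rho$; the unique minimizer (for $p>1$) is the optimal admissible density. Under conductive uniformity $\mathcal M_p:=\mathrm{Mod}_p(\Theta(I_{v,e},I_{u,e}),G_1)$ does not depend on $e=\{v,u\}\in E_1$. The $p$-walk dimension is $d_{w,p}:=\frac{\log(|E_1|\cdot\mathcal M_p^{-1})}{\log L_*}$. *)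

theory Defs
  imports "HOL-Analysis.Analysis"
begin

section \<open>Finite simple graphs and paths\<close>

locale finite_simple_graph =
  fixes V :: "'v set" and E :: "'v set set"
  assumes finite_vertices: "finite V"
    and edges: "e \<in> E \<Longrightarrow> e \<subseteq> V \<and> card e = 2"

definition is_path :: "'v set \<Rightarrow> 'v set set \<Rightarrow> 'v list \<Rightarrow> bool" where
  "is_path V E vs \<longleftrightarrow>
     vs \<noteq> [] \<and> set vs \<subseteq> V \<and> (\<forall>i. Suc i < length vs \<longrightarrow> {vs ! i, vs ! Suc i} \<in> E)"

definition paths_between :: "'v set \<Rightarrow> 'v set set \<Rightarrow> 'v set \<Rightarrow> 'v set \<Rightarrow> 'v list set" where
  "paths_between V E A B = {vs. is_path V E vs \<and> hd vs \<in> A \<and> last vs \<in> B}"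

locale connected_graph = finite_simple_graph +
  assumes connected: "x \<in> V \<Longrightarrow> y \<in> V \<Longrightarrow> paths_between V E {x} {y} \<noteq> {}"

text \<open>The path metric of a connected graph: the least number of edges of a path.\<close>
definition graph_dist :: "'v set \<Rightarrow> 'v set set \<Rightarrow> 'v \<Rightarrow> 'v \<Rightarrow> nat" where
  "graph_dist V E x y = (LEAST n. \<exists>vs \<in> paths_between V E {x} {y}. length vs = Suc n)"

definition degree :: "'v set set \<Rightarrow> 'v \<Rightarrow> nat" where
  "degree E x = card {y. {x, y} \<in> E}"

text \<open>Only meaningful at vertices of degree one.\<close>
definition the_neighbour :: "'v set set \<Rightarrow> 'v \<Rightarrow> 'v" where
  "the_neighbour E x = (THE y. {x, y} \<in> E)"

definition independent_set :: "'v set set \<Rightarrow> 'v set \<Rightarrow> bool" where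
  "independent_set E S \<longleftrightarrow> (\<forall>x \<in> S. \<forall>y \<in> S. {x, y} \<notin> E)"

section \<open>Flows\<close>

definition divergence :: "'v set set \<Rightarrow> ('v \<Rightarrow> 'v \<Rightarrow> real) \<Rightarrow> 'v \<Rightarrow> real" where
  "divergence E F x = (\<Sum>y | {x, y} \<in> E. F x y)"

definition is_flow ::
    "'v set \<Rightarrow> 'v set set \<Rightarrow> 'v set \<Rightarrow> 'v set \<Rightarrow> ('v \<Rightarrow> 'v \<Rightarrow> real) \<Rightarrow> bool" where
  "is_flow V E A B F \<longleftrightarrow>
     (\<forall>x y. F x y = - F y x) \<and>
     (\<forall>x y. {x, y} \<notin> E \<longrightarrow> F x y = 0) \<and>
     (\<forall>x \<in> V - (A \<union> B). divergence E F x = 0)"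

definition is_unit_flow ::
    "'v set \<Rightarrow> 'v set set \<Rightarrow> 'v set \<Rightarrow> 'v set \<Rightarrow> ('v \<Rightarrow> 'v \<Rightarrow> real) \<Rightarrow> bool" where
  "is_unit_flow V E A B F \<longleftrightarrow> is_flow V E A B F \<and> (\<Sum>x \<in> A. divergence E F x) = 1"

text \<open>The absolute value of an antisymmetric function on an unoriented edge; it does
  not depend on the order of the two endpoints.\<close>
definition abs_on_edge :: "('v \<Rightarrow> 'v \<Rightarrow> real) \<Rightarrow> 'v set \<Rightarrow> real" where
  "abs_on_edge F e = (THE r. \<exists>x y. e = {x, y} \<and> r = \<bar>F x y\<bar>)"

lemma abs_on_edge_eq:
  assumes "\<forall>x y. F x y = - F y x"
  shows "abs_on_edge F {x, y} = \<bar>F x y\<bar>"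
proof -
  have "\<bar>F x y\<bar> = \<bar>F y x\<bar>"
    using assms by (metis abs_minus_cancel)
  then show ?thesis
    unfolding abs_on_edge_def by (intro the_equality) (auto simp: doubleton_eq_iff)
qed

definition flow_energy :: "'v set set \<Rightarrow> real \<Rightarrow> ('v \<Rightarrow> 'v \<Rightarrow> real) \<Rightarrow> real" where
  "flow_energy E q F = (\<Sum>e \<in> E. abs_on_edge F e powr q)"

definition minimal_unit_flow ::
    "'v set \<Rightarrow> 'v set set \<Rightarrow> real \<Rightarrow> 'v set \<Rightarrow> 'v set \<Rightarrow> 'v \<Rightarrow> 'v \<Rightarrow> real" where
  "minimal_unit_flow V E q A B =
     (THE F. is_unit_flow V E A B F \<and>
             (\<forall>G. is_unit_flow V E A B G \<longrightarrow> flow_energy E q F \<le> flow_energy E q G))"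

section \<open>Modulus\<close>

text \<open>Densities are functions on \<open>E\<close>; values outside \<open>E\<close> are irrelevant.\<close>
definition admissible :: "'v set set \<Rightarrow> 'v list set \<Rightarrow> ('v set \<Rightarrow> real) \<Rightarrow> bool" where
  "admissible E \<Theta> \<rho> \<longleftrightarrow>
     (\<forall>e \<in> E. 0 \<le> \<rho> e) \<and>
     (\<forall>vs \<in> \<Theta>. 1 \<le> (\<Sum>i < length vs - 1. \<rho> {vs ! i, vs ! Suc i}))"

definition density_mass :: "'v set set \<Rightarrow> real \<Rightarrow> ('v set \<Rightarrow> real) \<Rightarrow> real" where
  "density_mass E p \<rho> = (\<Sum>e \<in> E. \<rho> e powr p)"

text \<open>A real infimum: admissible densities exist as soon as \<open>\<Theta>\<close> contains no one-vertex
  path, in particular for paths between disjoint sets.\<close>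
definition modulus :: "'v set set \<Rightarrow> real \<Rightarrow> 'v list set \<Rightarrow> real" where
  "modulus E p \<Theta> = (INF \<rho> \<in> {\<rho>. admissible E \<Theta> \<rho>}. density_mass E p \<rho>)"

text \<open>\<open>\<rho>\<close> is the unique minimizer, uniqueness being that of functions on \<open>E\<close>.\<close>
definition is_optimal_density ::
    "'v set set \<Rightarrow> real \<Rightarrow> 'v list set \<Rightarrow> ('v set \<Rightarrow> real) \<Rightarrow> bool" where
  "is_optimal_density E p \<Theta> \<rho> \<longleftrightarrow>
     admissible E \<Theta> \<rho> \<and> density_mass E p \<rho> = modulus E p \<Theta> \<and>
     (\<forall>\<sigma>. admissible E \<Theta> \<sigma> \<and> density_mass E p \<sigma> = modulus E p \<Theta> \<longrightarrow> (\<forall>e \<in> E. \<sigma> e = \<rho> e))"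

section \<open>Iterated graph systems\<close>

text \<open>A pair \<open>v \<in> e \<in> E\<close> is given by its ordered pair of endpoints \<open>(v, u)\<close>,
  where \<open>e = {v, u}\<close>. Thus \<open>glue_set I \<phi> v u\<close> is $I_{v,e}$.\<close>
definition glue_set :: "'i set \<Rightarrow> ('v \<Rightarrow> 'v set \<Rightarrow> 'i \<Rightarrow> 'v) \<Rightarrow> 'v \<Rightarrow> 'v \<Rightarrow> 'v set" where
  "glue_set I \<phi> v u = \<phi> v {v, u} ` I"

locale iterated_graph_system = connected_graph V E
  for V :: "'v set" and E :: "'v set set" +
  fixes I :: "'i set" and \<phi> :: "'v \<Rightarrow> 'v set \<Rightarrow> 'i \<Rightarrow> 'v"
  assumes edge_exists: "E \<noteq> {}"
    and finite_I: "finite I"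
    and nonempty_I: "I \<noteq> {}"
    and phi_in_V: "{v, u} \<in> E \<Longrightarrow> \<phi> v {v, u} ` I \<subseteq> V"
    and phi_inj: "{v, u} \<in> E \<Longrightarrow> inj_on (\<phi> v {v, u}) I"
    and glue_independent: "{v, u} \<in> E \<Longrightarrow> independent_set E (glue_set I \<phi> v u)"
    and glue_disjoint: "{v, u} \<in> E \<Longrightarrow> glue_set I \<phi> v u \<inter> glue_set I \<phi> u v = {}"

definition uniform_scaling ::
    "'v set \<Rightarrow> 'v set set \<Rightarrow> 'i set \<Rightarrow> ('v \<Rightarrow> 'v set \<Rightarrow> 'i \<Rightarrow> 'v) \<Rightarrow> nat \<Rightarrow> bool" where
  "uniform_scaling V E I \<phi> L \<longleftrightarrow>
     (\<forall>v u. {v, u} \<in> E \<longrightarrow>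
        (\<forall>x \<in> glue_set I \<phi> v u. \<forall>y \<in> glue_set I \<phi> u v. graph_dist V E x y = L))"

definition doubling ::
    "'v set set \<Rightarrow> 'i set \<Rightarrow> ('v \<Rightarrow> 'v set \<Rightarrow> 'i \<Rightarrow> 'v) \<Rightarrow> bool" where
  "doubling E I \<phi> \<longleftrightarrow>
     (\<forall>v u. {v, u} \<in> E \<longrightarrow> (\<forall>z \<in> glue_set I \<phi> v u. degree E z = 1))"

text \<open>$\mathcal{F}_{v,e}$ for \<open>e = {v, u}\<close>.\<close>
definition edge_flow ::
    "'v set \<Rightarrow> 'v set set \<Rightarrow> 'i set \<Rightarrow> ('v \<Rightarrow> 'v set \<Rightarrow> 'i \<Rightarrow> 'v) \<Rightarrow> real \<Rightarrow>
     'v \<Rightarrow> 'v \<Rightarrow> 'v \<Rightarrow> 'v \<Rightarrow> real" where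
  "edge_flow V E I \<phi> q v u = minimal_unit_flow V E q (glue_set I \<phi> v u) (glue_set I \<phi> u v)"

definition dual_exponent :: "real \<Rightarrow> real" where
  "dual_exponent p = p / (p - 1)"

definition conductively_uniform ::
    "'v set \<Rightarrow> 'v set set \<Rightarrow> 'i set \<Rightarrow> ('v \<Rightarrow> 'v set \<Rightarrow> 'i \<Rightarrow> 'v) \<Rightarrow> bool" where
  "conductively_uniform V E I \<phi> \<longleftrightarrow>
     (\<forall>p > 1. let q = dual_exponent p in
        \<forall>v u v' u'. {v, u} \<in> E \<longrightarrow> {v', u'} \<in> E \<longrightarrow>
          (\<forall>a \<in> I.
             edge_flow V E I \<phi> q v u (\<phi> v {v, u} a) (the_neighbour E (\<phi> v {v, u} a)) =
             edge_flow V E I \<phi> q v' u' (\<phi> v' {v', u'} a) (the_neighbour E (\<phi> v' {v', u'} a))) \<and>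
          flow_energy E q (edge_flow V E I \<phi> q v u) =
          flow_energy E q (edge_flow V E I \<phi> q v' u'))"

definition edge_paths ::
    "'v set \<Rightarrow> 'v set set \<Rightarrow> 'i set \<Rightarrow> ('v \<Rightarrow> 'v set \<Rightarrow> 'i \<Rightarrow> 'v) \<Rightarrow> 'v \<Rightarrow> 'v \<Rightarrow> 'v list set" where
  "edge_paths V E I \<phi> v u = paths_between V E (glue_set I \<phi> v u) (glue_set I \<phi> u v)"

text \<open>The common value $\mathcal{M}_p$ of the moduli, which under conductive uniformity does
  not depend on the edge.\<close>
definition igs_modulus ::
    "'v set \<Rightarrow> 'v set set \<Rightarrow> 'i set \<Rightarrow> ('v \<Rightarrow> 'v set \<Rightarrow> 'i \<Rightarrow> 'v) \<Rightarrow> real \<Rightarrow> real" where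
  "igs_modulus V E I \<phi> p =
     (THE m. \<forall>v u. {v, u} \<in> E \<longrightarrow> modulus E p (edge_paths V E I \<phi> v u) = m)"

definition walk_dimension ::
    "'v set \<Rightarrow> 'v set set \<Rightarrow> 'i set \<Rightarrow> ('v \<Rightarrow> 'v set \<Rightarrow> 'i \<Rightarrow> 'v) \<Rightarrow> nat \<Rightarrow> real \<Rightarrow> real" where
  "walk_dimension V E I \<phi> L p =
     ln (real (card E) * inverse (igs_modulus V E I \<phi> p)) / ln (real L)"

end

theory Submission
  imports Defs
begin

text \<open>
  Every path from $I_{v,e}$ to $I_{u,e}$ has at least $L_*$ edges, so the constant density
  $L_*^{-1}$ is admissible and $\mathcal{M}_p \le |E_1| L_*^{-p}$, with equality exactly when
  this density is the (unique) minimizer; taking logarithms gives the claim. What remains is that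
  $\mathcal{M}_p$ is well defined, positive and attained. This comes from the duality between
  flows and modulus: if \<open>U\<close> minimizes the $p$-energy among the functions equal to 0 on
  $A$ and to 1 on $B$, and \<open>C\<close> is this energy, then $C^{-1} |\nabla U|^{p-2} \nabla U$
  is the minimal unit flow, of $q$-energy $C^{1-q}$, and $|\nabla U|$ is the optimal density, of
  mass \<open>C\<close>. Both minimality statements, with uniqueness, follow from the strict tangent
  inequality for $|x|^r$. Hence equal flow energies on all edges force equal moduli.
\<close>

section \<open>Signed powers\<close>

text \<open>For r = p - 1 this is the nonlinearity |x|^(p-2) x of the p-Laplacian. Writing it with
  \<open>sgn\<close> keeps the exponent positive for every p > 1.\<close>

definition signed_powr :: "real \<Rightarrow> real \<Rightarrow> real" where
  "signed_powr r x = sgn x * \<bar>x\<bar> powr r"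

lemma signed_powr_minus: "signed_powr r (- x) = - signed_powr r x"
  by (simp add: signed_powr_def sgn_minus)

lemma abs_signed_powr: "\<bar>signed_powr r x\<bar> = \<bar>x\<bar> powr r"
  by (simp add: signed_powr_def abs_mult abs_sgn_eq)

lemma signed_powr_mult_self: "signed_powr (r - 1) x * x = \<bar>x\<bar> powr r"
proof (cases "x = 0")
  case False
  then have "\<bar>x\<bar> powr r = \<bar>x\<bar> powr (r - 1) * \<bar>x\<bar>"
    by (simp add: powr_mult_base flip: powr_mult_base' mult.commute[of "\<bar>x\<bar>"])
  then show ?thesis
    by (simp add: signed_powr_def sgn_if)
qed (simp add: signed_powr_def)

lemma signed_powr_mult: "signed_powr r (x * y) = signed_powr r x * signed_powr r y"
  by (simp add: signed_powr_def sgn_mult abs_mult powr_mult)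

text \<open>If (p - 1) * (q - 1) = 1, the signed powers with exponents p - 1 and q - 1 are thus
  inverse to each other, which recovers a gradient from its flow.\<close>

lemma signed_powr_signed_powr: "signed_powr s (signed_powr r x) = signed_powr (r * s) x"
  by (simp add: signed_powr_def abs_mult powr_powr sgn_mult abs_sgn_eq sgn_if)

lemma signed_powr_1: "signed_powr 1 x = x"
  by (simp add: signed_powr_def sgn_if)

lemma strict_mono_signed_powr:
  assumes "0 < r"
  shows "strict_mono (signed_powr r)"
proof (rule strict_monoI)
  fix x y :: real
  assume "x < y"
  then show "signed_powr r x < signed_powr r y"
    using assms powr_less_mono2[of r x y] powr_less_mono2[of r "-y" "-x"]
    by (cases "x < 0"; cases "y > 0")
      (auto simp: signed_powr_def sgn_if intro: order.strict_trans[of _ 0] split: if_splits)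
qed

text \<open>Away from 0 the absolute value resolves to x or -x on an open half-line. At 0 the
  difference quotient is \<open>signed_powr (r - 1) h\<close>, which tends to 0 because r >
  1.\<close>

lemma has_real_derivative_abs_powr:
  assumes "1 < r"
  shows "((\<lambda>x. \<bar>x\<bar> powr r) has_real_derivative r * signed_powr (r - 1) x) (at x)"
proof -
  consider "x > 0" | "x < 0" | "x = 0" by linarith
  then show ?thesis
  proof cases
    case 1
    have "((\<lambda>x. x powr r) has_real_derivative r * x powr (r - 1)) (at x)"
      using 1 by (rule has_real_derivative_powr)
    then have "((\<lambda>x. \<bar>x\<bar> powr r) has_real_derivative r * x powr (r - 1)) (at x)"
      by (rule has_field_derivative_transform_within_open[where S = "{0<..}"]) (use 1 in auto)
    with 1 show ?thesis by (simp add: signed_powr_def)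
  next
    case 2
    have "((\<lambda>x. (- x) powr r) has_real_derivative - (r * (- x) powr (r - 1))) (at x)"
      using 2 by (auto intro!: derivative_eq_intros)
    then have "((\<lambda>x. \<bar>x\<bar> powr r) has_real_derivative - (r * (- x) powr (r - 1))) (at x)"
      by (rule has_field_derivative_transform_within_open[where S = "{..<0}"]) (use 2 in auto)
    with 2 show ?thesis by (simp add: signed_powr_def)
  next
    case 3
    have "((\<lambda>h. signed_powr (r - 1) h) \<longlongrightarrow> 0) (at 0)"
    proof (rule Lim_null_comparison)
      show "\<forall>\<^sub>F h in at 0. norm (signed_powr (r - 1) h) \<le> \<bar>h\<bar> powr (r - 1)"
        by (simp add: abs_signed_powr)
      have "((\<lambda>h. \<bar>h\<bar> powr (r - 1)) \<longlongrightarrow> \<bar>0::real\<bar> powr (r - 1)) (at 0)"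
        by (intro tendsto_powr2 tendsto_intros) (use assms in auto)
      then show "((\<lambda>h::real. \<bar>h\<bar> powr (r - 1)) \<longlongrightarrow> 0) (at 0)"
        by simp
    qed
    moreover have "signed_powr (r - 1) h = \<bar>h\<bar> powr r / h" if "h \<noteq> 0" for h
      using that signed_powr_mult_self[of r h] by (simp add: field_simps)
    ultimately have "((\<lambda>h. \<bar>h\<bar> powr r / h) \<longlongrightarrow> 0) (at 0)"
      by (subst Lim_cong_within[where g = "signed_powr (r - 1)"]) auto
    with 3 show ?thesis by (simp add: DERIV_def signed_powr_def)
  qed
qed

text \<open>The derivative is strictly increasing, so the mean value theorem puts the graph strictly
  above its tangent. This strictness is the source of both uniqueness claims.\<close>

lemma abs_powr_tangent_less:
  assumes "1 < r" "a \<noteq> b"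
  shows "\<bar>a\<bar> powr r + r * signed_powr (r - 1) a * (b - a) < \<bar>b\<bar> powr r"
proof -
  note deriv = has_real_derivative_abs_powr[OF \<open>1 < r\<close>]
  have mono: "signed_powr (r - 1) x < signed_powr (r - 1) y" if "x < y" for x y
    using strict_mono_signed_powr[of "r - 1"] that \<open>1 < r\<close> by (simp add: strict_mono_def)
  consider "a < b" | "b < a" using \<open>a \<noteq> b\<close> by linarith
  then show ?thesis
  proof cases
    case 1
    then obtain z where z: "a < z" "\<bar>b\<bar> powr r - \<bar>a\<bar> powr r = (b - a) * (r * signed_powr (r - 1) z)"
      using MVT2[OF 1 deriv] by blast
    have "r * signed_powr (r - 1) a * (b - a) < r * signed_powr (r - 1) z * (b - a)"
      using 1 mono[OF z(1)] \<open>1 < r\<close> by simp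
    with z show ?thesis by (simp add: mult_ac)
  next
    case 2
    then obtain z where z: "z < a" "\<bar>a\<bar> powr r - \<bar>b\<bar> powr r = (a - b) * (r * signed_powr (r - 1) z)"
      using MVT2[OF 2 deriv] by blast
    have "r * signed_powr (r - 1) z * (a - b) < r * signed_powr (r - 1) a * (a - b)"
      using 2 mono[OF z(1)] \<open>1 < r\<close> by simp
    with z show ?thesis by (simp add: algebra_simps)
  qed
qed

lemma abs_powr_tangent_le:
  assumes "1 < r"
  shows "\<bar>a\<bar> powr r + r * signed_powr (r - 1) a * (b - a) \<le> \<bar>b\<bar> powr r"
  using abs_powr_tangent_less[OF assms, of a b] by (cases "a = b") auto

text \<open>A first-order criterion: up to the factor r, the hypothesis says that the directional
  derivative at \<open>f\<close> towards \<open>g\<close> is nonnegative, and convexity does the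
  rest. It serves densities with r = p and flows with r = q.\<close>

lemma sum_powr_tangent_le:
  assumes "1 < r" and "0 \<le> (\<Sum>a \<in> S. signed_powr (r - 1) (f a) * (g a - f a))"
  shows "(\<Sum>a \<in> S. \<bar>f a\<bar> powr r) \<le> (\<Sum>a \<in> S. \<bar>g a\<bar> powr r)"
proof -
  have "(\<Sum>a \<in> S. \<bar>f a\<bar> powr r) \<le>
      (\<Sum>a \<in> S. \<bar>f a\<bar> powr r + r * (signed_powr (r - 1) (f a) * (g a - f a)))"
    using assms by (simp add: sum.distrib flip: sum_distrib_left)
  also have "\<dots> \<le> (\<Sum>a \<in> S. \<bar>g a\<bar> powr r)"
    using abs_powr_tangent_le[OF \<open>1 < r\<close>] by (intro sum_mono) (simp add: mult.assoc)
  finally show ?thesis .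
qed

text \<open>A single index where \<open>f\<close> and \<open>g\<close> differ would make the summed
  tangent inequality strict.\<close>

lemma sum_powr_tangent_eqD:
  assumes "1 < r" "finite S"
    and "0 \<le> (\<Sum>a \<in> S. signed_powr (r - 1) (f a) * (g a - f a))"
    and eq: "(\<Sum>a \<in> S. \<bar>g a\<bar> powr r) = (\<Sum>a \<in> S. \<bar>f a\<bar> powr r)"
  shows "\<forall>a \<in> S. g a = f a"
proof (rule ccontr)
  assume "\<not> (\<forall>a \<in> S. g a = f a)"
  then obtain a where "a \<in> S" "f a \<noteq> g a" by auto
  have "(\<Sum>a \<in> S. \<bar>f a\<bar> powr r) \<le>
      (\<Sum>a \<in> S. \<bar>f a\<bar> powr r + r * (signed_powr (r - 1) (f a) * (g a - f a)))"
    using assms by (simp add: sum.distrib flip: sum_distrib_left)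
  also have "\<dots> < (\<Sum>a \<in> S. \<bar>g a\<bar> powr r)"
  proof (rule sum_strict_mono_strong[OF \<open>finite S\<close> \<open>a \<in> S\<close>])
    show "\<bar>f a\<bar> powr r + r * (signed_powr (r - 1) (f a) * (g a - f a)) < \<bar>g a\<bar> powr r"
      using abs_powr_tangent_less[OF \<open>1 < r\<close> \<open>f a \<noteq> g a\<close>] by (simp add: mult.assoc)
  qed (use abs_powr_tangent_le[OF \<open>1 < r\<close>] in \<open>simp add: mult.assoc\<close>)
  finally show False using eq by simp
qed

section \<open>Gradients and flows\<close>

text \<open>Keeping both orientations of an edge allows sums of antisymmetric functions without
  choosing one. The price is a factor 2 against sums over \<open>E\<close>, visible in the constants
  below.\<close>

definition arcs :: "'v set set \<Rightarrow> ('v \<times> 'v) set" where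
  "arcs E = {(x, y). {x, y} \<in> E}"

lemma sum_arcs_swap: "(\<Sum>(x, y) \<in> arcs E. f y x) = (\<Sum>(x, y) \<in> arcs E. f x y)"
  by (rule sum.reindex_bij_witness[of _ prod.swap prod.swap])
    (auto simp: arcs_def insert_commute)

definition is_potential :: "'v set \<Rightarrow> 'v set \<Rightarrow> ('v \<Rightarrow> real) \<Rightarrow> bool" where
  "is_potential A B W \<longleftrightarrow> (\<forall>x \<in> A. W x = 0) \<and> (\<forall>x \<in> B. W x = 1)"

text \<open>This is twice the p-energy over unoriented edges, hence the constant
  \<open>gradient_energy E p U / 2\<close> later.\<close>

definition gradient_energy :: "'v set set \<Rightarrow> real \<Rightarrow> ('v \<Rightarrow> real) \<Rightarrow> real" where
  "gradient_energy E p W = (\<Sum>(x, y) \<in> arcs E. \<bar>W y - W x\<bar> powr p)"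

section \<open>Integration by parts and the minimal potential on a finite graph\<close>

context finite_simple_graph
begin

lemma finite_edges: "finite E"
  using finite_vertices edges by (auto intro: finite_subset[of E "Pow V"])

lemma edge_ends: "{x, y} \<in> E \<Longrightarrow> x \<in> V \<and> y \<in> V \<and> x \<noteq> y"
  using edges[of "{x, y}"] by (auto simp: card_insert_if split: if_splits)

lemma edge_as_pair: "e \<in> E \<Longrightarrow> \<exists>x y. e = {x, y} \<and> x \<noteq> y"
  using edges[of e] by (auto simp: card_2_iff)

lemma finite_neighbours: "finite {y. {x, y} \<in> E}"
  using edge_ends finite_vertices by (auto intro: finite_subset[of _ V])

lemma arcs_eq_Sigma: "arcs E = Sigma V (\<lambda>x. {y. {x, y} \<in> E})"
  using edge_ends by (auto simp: arcs_def)

lemma finite_arcs: "finite (arcs E)"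
  by (simp add: arcs_eq_Sigma finite_vertices finite_neighbours)

lemma sum_arcs_eq_edges: "(\<Sum>(x, y) \<in> arcs E. f {x, y}) = 2 * (\<Sum>e \<in> E. f e :: real)"
proof -
  have "(\<Sum>(x, y) \<in> arcs E. f {x, y}) =
      (\<Sum>e \<in> E. \<Sum>a \<in> {a \<in> arcs E. (case a of (x, y) \<Rightarrow> {x, y}) = e}. case a of (x, y) \<Rightarrow> f {x, y})"
    by (rule sum.group[symmetric]) (use finite_arcs finite_edges in \<open>auto simp: arcs_def\<close>)
  also have "\<dots> = (\<Sum>e \<in> E. 2 * f e)"
  proof (rule sum.cong[OF refl])
    fix e assume "e \<in> E"
    then obtain x y where e: "e = {x, y}" "x \<noteq> y" using edge_as_pair by blast
    with \<open>e \<in> E\<close> have "{a \<in> arcs E. (case a of (x, y) \<Rightarrow> {x, y}) = e} = {(x, y), (y, x)}"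
      by (auto simp: arcs_def doubleton_eq_iff insert_commute)
    with e show "(\<Sum>a \<in> {a \<in> arcs E. (case a of (x, y) \<Rightarrow> {x, y}) = e}. case a of (x, y) \<Rightarrow> f {x, y}) = 2 * f e"
      by (simp add: insert_commute)
  qed
  finally show ?thesis by (simp add: sum_distrib_left)
qed

text \<open>Discrete integration by parts: reversing arcs turns the part with \<open>W y\<close>
  into the negative of the part with \<open>W x\<close>.\<close>

lemma sum_arcs_mult_gradient:
  assumes anti: "\<And>x y. F x y = - F y x"
  shows "(\<Sum>(x, y) \<in> arcs E. F x y * (W y - W x)) = - 2 * (\<Sum>x \<in> V. W x * divergence E F x)"
proof -
  have "(\<Sum>(x, y) \<in> arcs E. F x y * W y) = (\<Sum>(x, y) \<in> arcs E. F y x * W x)"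
    using sum_arcs_swap[of "\<lambda>x y. F y x * W x"] by simp
  also have "\<dots> = (\<Sum>(x, y) \<in> arcs E. - (F x y * W x))"
    by (intro sum.cong refl) (metis (no_types, lifting) anti minus_mult_left split_beta)
  also have "\<dots> = - (\<Sum>(x, y) \<in> arcs E. F x y * W x)"
    by (simp add: split_beta sum_negf)
  finally have "(\<Sum>(x, y) \<in> arcs E. F x y * (W y - W x)) = - 2 * (\<Sum>(x, y) \<in> arcs E. F x y * W x)"
    by (simp add: split_beta right_diff_distrib sum_subtractf)
  also have "(\<Sum>(x, y) \<in> arcs E. F x y * W x) = (\<Sum>x \<in> V. W x * divergence E F x)"
    unfolding arcs_eq_Sigma divergence_def
    by (subst sum.Sigma[symmetric])
      (auto simp: finite_vertices finite_neighbours sum_distrib_left mult.commute)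
  finally show ?thesis .
qed

lemma sum_total_divergence:
  assumes "\<And>x y. F x y = - F y x"
  shows "(\<Sum>x \<in> V. divergence E F x) = 0"
  using sum_arcs_mult_gradient[OF assms, where W = "\<lambda>_. 1"] by simp


lemma flow_energy_eq_arcs:
  assumes "\<forall>x y. F x y = - F y x"
  shows "2 * flow_energy E q F = (\<Sum>(x, y) \<in> arcs E. \<bar>F x y\<bar> powr q)"
  using sum_arcs_eq_edges[of "\<lambda>e. abs_on_edge F e powr q"]
  by (simp add: flow_energy_def abs_on_edge_eq[OF assms])

text \<open>After integration by parts only the boundary counts: \<open>W\<close> vanishes on
  \<open>A\<close>, and the total divergence on \<open>B\<close> is -1 because all divergences sum
  to 0. The value is the same for every unit flow and every potential, which drives both optimality
  proofs.\<close>

lemma sum_unit_flow_gradient: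
  assumes "A \<subseteq> V" "B \<subseteq> V" "A \<inter> B = {}"
    and F: "is_unit_flow V E A B F" and W: "is_potential A B W"
  shows "(\<Sum>(x, y) \<in> arcs E. F x y * (W y - W x)) = 2"
proof -
  have anti: "F x y = - F y x" for x y
    using F unfolding is_unit_flow_def is_flow_def by blast
  have div0: "divergence E F x = 0" if "x \<in> V - (A \<union> B)" for x
    using F that unfolding is_unit_flow_def is_flow_def by blast
  have fin: "finite A" "finite B"
    using assms finite_vertices finite_subset by blast+
  have split: "(\<Sum>x \<in> V. g x * divergence E F x) =
      (\<Sum>x \<in> A. g x * divergence E F x) + (\<Sum>x \<in> B. g x * divergence E F x)" for g
  proof -
    have "(\<Sum>x \<in> V. g x * divergence E F x) = (\<Sum>x \<in> A \<union> B. g x * divergence E F x)"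
      by (rule sum.mono_neutral_right)
        (use assms div0 finite_vertices in auto)
    then show ?thesis
      using fin assms by (simp add: sum.union_disjoint)
  qed
  have "(\<Sum>x \<in> A. divergence E F x) + (\<Sum>x \<in> B. divergence E F x) = 0"
    using split[of "\<lambda>_. 1"] sum_total_divergence[of F, OF anti] by simp
  moreover have "(\<Sum>x \<in> A. divergence E F x) = 1"
    using F by (simp add: is_unit_flow_def)
  moreover have "(\<Sum>x \<in> V. W x * divergence E F x) = (\<Sum>x \<in> B. divergence E F x)"
    using W by (simp add: split is_potential_def)
  ultimately show ?thesis
    using sum_arcs_mult_gradient[of F W, OF anti] by simp
qed

text \<open>The energy is continuous on the compact set of potentials with values in [0, 1], and
  truncation reduces all other potentials to these.\<close>

lemma exists_minimal_potential:
  assumes "A \<inter> B = {}" "1 < p"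
  shows "\<exists>U. is_potential A B U \<and>
    (\<forall>W. is_potential A B W \<longrightarrow> gradient_energy E p U \<le> gradient_energy E p W)"
proof -
  \<comment> \<open>Coordinates outside \<open>V\<close> are confined as well, so that Tychonoff's
    theorem applies in the full function space.\<close>
  define S where "S x = (if x \<in> A then {0} else if x \<in> B then {1} else {0..1::real})" for x
  define K where "K = PiE UNIV S"
  have "compact K"
    using compactin_PiE[of "\<lambda>_. euclidean" UNIV S]
    by (auto simp: K_def S_def euclidean_product_topology compactin_euclidean_iff)
  moreover have "(\<lambda>x. if x \<in> B then 1 else 0) \<in> K"
    using assms by (auto simp: K_def S_def)
  moreover have "continuous_on K (gradient_energy E p)"
    unfolding gradient_energy_def split_beta
    using assms
    by (intro continuous_intros continuous_on_powr'
        continuous_on_subset[OF continuous_on_product_coordinates]) auto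
  ultimately obtain U where "U \<in> K"
    and U: "\<And>W. W \<in> K \<Longrightarrow> gradient_energy E p U \<le> gradient_energy E p W"
    using continuous_attains_inf[of K "gradient_energy E p"] by blast
  have "is_potential A B U"
    using \<open>U \<in> K\<close> assms by (force simp: K_def S_def is_potential_def PiE_iff split: if_splits)
  moreover have "gradient_energy E p U \<le> gradient_energy E p W" if "is_potential A B W" for W
  proof -
    \<comment> \<open>Clamping to [0, 1] is 1-Lipschitz and fixes the boundary values 0 and 1, so it
      does not increase the energy.\<close>
    define T where "T x = min 1 (max 0 (W x))" for x
    have "T \<in> K"
      using that by (auto simp: K_def S_def T_def is_potential_def)
    moreover have "gradient_energy E p T \<le> gradient_energy E p W"
      unfolding gradient_energy_def split_beta
      by (intro sum_mono powr_mono2) (use assms in \<open>auto simp: T_def\<close>)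
    ultimately show ?thesis using U order_trans by blast
  qed
  ultimately show ?thesis by blast
qed

text \<open>The weak Euler-Lagrange equation: as \<psi> vanishes on the boundary, U + t \<psi>
  competes with \<open>U\<close> for every t, and its energy is minimal at t = 0.\<close>

lemma minimal_potential_harmonic:
  assumes "1 < p" and U: "is_potential A B U"
    and min: "\<And>W. is_potential A B W \<Longrightarrow> gradient_energy E p U \<le> gradient_energy E p W"
    and psi: "\<And>x. x \<in> A \<union> B \<Longrightarrow> \<psi> x = 0"
  shows "(\<Sum>(x, y) \<in> arcs E. signed_powr (p - 1) (U y - U x) * (\<psi> y - \<psi> x)) = 0"
proof -
  define h where "h t = gradient_energy E p (\<lambda>x. U x + t * \<psi> x)" for t
  have "(h has_real_derivative
      (\<Sum>(x, y) \<in> arcs E. p * signed_powr (p - 1) (U y - U x) * (\<psi> y - \<psi> x))) (at 0)"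
    unfolding h_def gradient_energy_def split_beta
  proof (rule DERIV_sum)
    fix a
    let ?u = "\<lambda>t. U (snd a) + t * \<psi> (snd a) - (U (fst a) + t * \<psi> (fst a))"
    have "(?u has_real_derivative \<psi> (snd a) - \<psi> (fst a)) (at 0)"
      by (auto intro!: derivative_eq_intros)
    from DERIV_chain2[OF has_real_derivative_abs_powr[OF \<open>1 < p\<close>] this]
    show "((\<lambda>t. \<bar>?u t\<bar> powr p) has_real_derivative
        p * signed_powr (p - 1) (U (snd a) - U (fst a)) * (\<psi> (snd a) - \<psi> (fst a))) (at 0)"
      by simp
  qed
  moreover have "h 0 \<le> h t" for t
    using min[of "\<lambda>x. U x + t * \<psi> x"] U psi by (auto simp: h_def is_potential_def)
  ultimately have "(\<Sum>(x, y) \<in> arcs E. p * signed_powr (p - 1) (U y - U x) * (\<psi> y - \<psi> x)) = 0"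
    by (intro DERIV_local_min[of h _ 0 1]) auto
  then show ?thesis
    using \<open>1 < p\<close> by (simp add: split_beta mult.assoc flip: sum_distrib_left)
qed

end

section \<open>The unit flow induced by the minimal potential of a connected graph\<close>

context connected_graph
begin

text \<open>Vanishing energy makes \<open>U\<close> constant along edges, hence along a path joining
  \<open>A\<close> to \<open>B\<close>, although it has to rise from 0 to 1.\<close>

lemma gradient_energy_pos:
  assumes "A \<subseteq> V" "B \<subseteq> V" "A \<noteq> {}" "B \<noteq> {}" and U: "is_potential A B U"
  shows "0 < gradient_energy E p U"
proof (rule ccontr)
  assume "\<not> 0 < gradient_energy E p U"
  moreover have "0 \<le> gradient_energy E p U"
    unfolding gradient_energy_def by (intro sum_nonneg) auto
  ultimately have "gradient_energy E p U = 0" by linarith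
  then have const: "U y = U x" if "{x, y} \<in> E" for x y
    using that finite_arcs unfolding gradient_energy_def
    by (subst (asm) sum_nonneg_eq_0_iff) (auto simp: arcs_def)
  obtain a b where "a \<in> A" "b \<in> B" using assms by blast
  then obtain vs where vs: "vs \<in> paths_between V E {a} {b}"
    using connected[of a b] assms by blast
  have "U (vs ! i) = U (vs ! 0)" if "i < length vs" for i
    using that
  proof (induction i)
    case (Suc i)
    then have "{vs ! i, vs ! Suc i} \<in> E"
      using vs by (auto simp: paths_between_def is_path_def)
    with Suc const show ?case by simp
  qed simp
  moreover have "vs \<noteq> []" "hd vs = a" "last vs = b"
    using vs by (auto simp: paths_between_def is_path_def)
  ultimately have "U b = U a"
    by (metis diff_less hd_conv_nth last_conv_nth length_greater_0_conv less_one)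
  with \<open>a \<in> A\<close> \<open>b \<in> B\<close> U show False by (simp add: is_potential_def)
qed

text \<open>The flow is the p-gradient of the minimal potential, conserved by harmonicity. The
  constant is forced, since a unit flow must pair with the gradient of \<open>U\<close> to 2. The
  pair (U, F) certifies optimality in both extremal problems below.\<close>

lemma exists_potential_flow:
  assumes AB: "A \<subseteq> V" "B \<subseteq> V" "A \<noteq> {}" "B \<noteq> {}" "A \<inter> B = {}" and "1 < p"
  obtains U :: "_ \<Rightarrow> real" and F where "is_potential A B U" "is_unit_flow V E A B F"
    "0 < gradient_energy E p U"
    "\<And>x y. {x, y} \<in> E \<Longrightarrow> signed_powr (p - 1) (U y - U x) = gradient_energy E p U / 2 * F x y"
proof -
  obtain U where U: "is_potential A B U"
    and min: "\<And>W. is_potential A B W \<Longrightarrow> gradient_energy E p U \<le> gradient_energy E p W"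
    using exists_minimal_potential AB \<open>1 < p\<close> by blast
  define C where "C = gradient_energy E p U / 2"
  have "C > 0" using gradient_energy_pos[OF AB(1-4) U] by (simp add: C_def)
  define F where "F x y = (if {x, y} \<in> E then signed_powr (p - 1) (U y - U x) / C else 0)" for x y
  have anti: "F x y = - F y x" for x y
  proof -
    have "{y, x} = {x, y}" by auto
    moreover have "signed_powr (p - 1) (U x - U y) = - signed_powr (p - 1) (U y - U x)"
      using signed_powr_minus[of "p - 1" "U y - U x"] by simp
    ultimately show ?thesis by (simp add: F_def)
  qed
  have F_mult: "(\<Sum>(x, y) \<in> arcs E. F x y * (\<psi> y - \<psi> x)) =
      (\<Sum>(x, y) \<in> arcs E. signed_powr (p - 1) (U y - U x) * (\<psi> y - \<psi> x)) / C" for \<psi>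
    unfolding sum_divide_distrib by (rule sum.cong) (auto simp: F_def arcs_def)
  have div0: "divergence E F z = 0" if z: "z \<in> V - (A \<union> B)" for z
  proof -
    \<comment> \<open>Testing harmonicity against the indicator of \<open>z\<close> isolates the
      divergence at \<open>z\<close>.\<close>
    define \<psi> :: "_ \<Rightarrow> real" where "\<psi> x = (if x = z then 1 else 0)" for x
    have "(\<Sum>(x, y) \<in> arcs E. F x y * (\<psi> y - \<psi> x)) = 0"
      unfolding F_mult
      by (subst minimal_potential_harmonic[OF \<open>1 < p\<close> U min]) (use z in \<open>auto simp: \<psi>_def\<close>)
    then have "(\<Sum>x \<in> V. \<psi> x * divergence E F x) = 0"
      using sum_arcs_mult_gradient[of F \<psi>, OF anti] by simp
    then show ?thesis
      using z finite_vertices by (simp add: \<psi>_def if_distrib[of "\<lambda>x. x * _"] cong: if_cong)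
  qed
  have flow: "is_flow V E A B F"
    unfolding is_flow_def
  proof (intro conjI allI impI ballI)
    show "F x y = - F y x" for x y by (rule anti)
  qed (use div0 in \<open>auto simp: F_def\<close>)
  have "(\<Sum>(x, y) \<in> arcs E. signed_powr (p - 1) (U y - U x) * (U y - U x)) = gradient_energy E p U"
    by (simp add: gradient_energy_def signed_powr_mult_self)
  then have energy: "(\<Sum>(x, y) \<in> arcs E. F x y * (U y - U x)) = 2"
    unfolding F_mult using \<open>C > 0\<close> by (simp add: C_def)
  \<comment> \<open>The function 1 - U is 1 on \<open>A\<close> and 0 on \<open>B\<close>, so it
    extracts the flux out of \<open>A\<close>; its gradient is the negative of that of
    \<open>U\<close>.\<close>
  have "(\<Sum>x \<in> V. (1 - U x) * divergence E F x) = (\<Sum>x \<in> A. divergence E F x)"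
  proof -
    have "(\<Sum>x \<in> V. (1 - U x) * divergence E F x) = (\<Sum>x \<in> A. (1 - U x) * divergence E F x)"
      by (rule sum.mono_neutral_right)
        (use AB U div0 finite_vertices in \<open>auto simp: is_potential_def\<close>)
    then show ?thesis using U by (simp add: is_potential_def)
  qed
  moreover have "- 2 * (\<Sum>x \<in> V. (1 - U x) * divergence E F x) = - 2"
    using sum_arcs_mult_gradient[of F "\<lambda>x. 1 - U x", OF anti] energy
    by (simp add: split_beta right_diff_distrib sum_subtractf)
  ultimately have "is_unit_flow V E A B F"
    using flow by (simp add: is_unit_flow_def)
  then show thesis
    using that[OF U] \<open>C > 0\<close> by (simp add: C_def F_def)
qed

section \<open>Duality of flows and modulus\<close>

text \<open>The potential is the $\sigma$-length distance to $A$, truncated at 1.\<close>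
lemma exists_dominated_potential:
  assumes AB: "A \<subseteq> V" "B \<subseteq> V" "A \<noteq> {}" and adm: "admissible E (paths_between V E A B) \<sigma>"
  obtains W :: "_ \<Rightarrow> real" where "is_potential A B W"
    "\<And>x y. {x, y} \<in> E \<Longrightarrow> \<bar>W y - W x\<bar> \<le> \<sigma> {x, y}"
proof -
  define len where "len vs = (\<Sum>i < length vs - 1. \<sigma> {vs ! i, vs ! Suc i})" for vs
  \<comment> \<open>A real infimum is meaningful only over a nonempty set bounded below; for
    vertices this comes from connectedness and from nonnegative lengths.\<close>
  define D where "D x = (INF vs \<in> paths_between V E A {x}. len vs)" for x
  have len_nonneg: "0 \<le> len vs" if "is_path V E vs" for vs
    unfolding len_def using that adm
    by (intro sum_nonneg) (auto simp: is_path_def admissible_def)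
  have bdd: "bdd_below (len ` paths_between V E A {x})" for x
    using len_nonneg by (intro bdd_belowI2[of _ 0]) (auto simp: paths_between_def)
  have nonempty: "paths_between V E A {x} \<noteq> {}" if "x \<in> V" for x
  proof -
    obtain a where "a \<in> A" using AB by blast
    then have "paths_between V E {a} {x} \<noteq> {}" using connected AB that by blast
    with \<open>a \<in> A\<close> show ?thesis by (auto simp: paths_between_def)
  qed
  \<comment> \<open>Every path to \<open>x\<close> extends by the edge {x, y} to a path to
    \<open>y\<close>.\<close>
  have step: "D y \<le> D x + \<sigma> {x, y}" if "{x, y} \<in> E" for x y
  proof -
    have "x \<in> V" "y \<in> V" using edge_ends that by auto
    have "D y - \<sigma> {x, y} \<le> len vs" if vs: "vs \<in> paths_between V E A {x}" for vs
    proof -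
      have "vs \<noteq> []" using vs by (auto simp: paths_between_def is_path_def)
      then obtain n where n: "length vs = Suc n" by (cases vs) auto
      then have "vs ! n = x"
        using vs \<open>vs \<noteq> []\<close> by (auto simp: paths_between_def last_conv_nth)
      have "vs @ [y] \<in> paths_between V E A {y}"
        using vs \<open>y \<in> V\<close> \<open>{x, y} \<in> E\<close> n \<open>vs ! n = x\<close>
        by (auto simp: paths_between_def is_path_def nth_append less_Suc_eq)
      then have "D y \<le> len (vs @ [y])"
        unfolding D_def by (rule cINF_lower[OF bdd])
      also have "len (vs @ [y]) = len vs + \<sigma> {x, y}"
        using n \<open>vs ! n = x\<close> by (simp add: len_def nth_append)
      finally show ?thesis by simp
    qed
    then have "D y - \<sigma> {x, y} \<le> D x"
      unfolding D_def[of x] using nonempty[OF \<open>x \<in> V\<close>] by (intro cINF_greatest) auto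
    then show ?thesis by simp
  qed
  have D_nonneg: "0 \<le> D x" if "x \<in> V" for x
    unfolding D_def using nonempty[OF that] len_nonneg
    by (intro cINF_greatest) (auto simp: paths_between_def)
  have D_A: "D x = 0" if "x \<in> A" for x
  proof -
    have "[x] \<in> paths_between V E A {x}"
      using that AB by (auto simp: paths_between_def is_path_def)
    then have "D x \<le> len [x]" unfolding D_def by (rule cINF_lower[OF bdd])
    moreover have "0 \<le> D x" using D_nonneg that AB by blast
    ultimately show ?thesis by (simp add: len_def)
  qed
  have D_B: "1 \<le> D x" if "x \<in> B" for x
  proof -
    have "x \<in> V" using that AB by blast
    moreover have "1 \<le> len vs" if "vs \<in> paths_between V E A {x}" for vs
      using that \<open>x \<in> B\<close> adm by (auto simp: admissible_def len_def paths_between_def)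
    ultimately show ?thesis
      unfolding D_def using nonempty by (intro cINF_greatest) auto
  qed
  show thesis
  proof
    \<comment> \<open>Admissibility gives only D \<ge> 1 on \<open>B\<close>; the truncation makes
      this an equality. It is 1-Lipschitz, so \<open>step\<close> in both orientations bounds the
      difference.\<close>
    show "is_potential A B (\<lambda>x. min 1 (D x))"
      using D_A D_B by (auto simp: is_potential_def)
    fix x y assume xy: "{x, y} \<in> E"
    moreover have "{y, x} = {x, y}" by auto
    ultimately show "\<bar>min 1 (D y) - min 1 (D x)\<bar> \<le> \<sigma> {x, y}"
      using step[of x y] step[of y x] by (auto simp: min_def abs_le_iff)
  qed
qed

text \<open>Along a path from \<open>A\<close> to \<open>B\<close> the increments of
  \<open>U\<close> telescope to 1.\<close>

lemma admissible_gradient: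
  assumes U: "is_potential A B U"
  shows "admissible E (paths_between V E A B) (abs_on_edge (\<lambda>x y. U y - U x))"
proof -
  have eq: "abs_on_edge (\<lambda>x y. U y - U x) {x, y} = \<bar>U y - U x\<bar>" for x y
    by (rule abs_on_edge_eq) simp
  have "1 \<le> (\<Sum>i < length vs - 1. \<bar>U (vs ! Suc i) - U (vs ! i)\<bar>)"
    if vs: "vs \<in> paths_between V E A B" for vs
  proof -
    have "U (last vs) - U (hd vs) = 1" "vs \<noteq> []"
      using U vs by (auto simp: paths_between_def is_potential_def is_path_def)
    then have "1 = (\<Sum>i < length vs - 1. U (vs ! Suc i) - U (vs ! i))"
      using sum_lessThan_telescope[of "\<lambda>i. U (vs ! i)" "length vs - 1"]
      by (simp add: hd_conv_nth last_conv_nth)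
    also have "\<dots> \<le> (\<Sum>i < length vs - 1. \<bar>U (vs ! Suc i) - U (vs ! i)\<bar>)"
      by (intro sum_mono) auto
    finally show ?thesis .
  qed
  moreover have "0 \<le> abs_on_edge (\<lambda>x y. U y - U x) e" if "e \<in> E" for e
    using edge_as_pair[OF that] eq by auto
  ultimately show ?thesis
    by (auto simp: admissible_def eq)
qed

text \<open>The derivative of the mass at \<rho> = |grad U| is weighted by C |F|. Any admissible
  \<sigma> dominates the gradient of a potential, so the sum of |F| \<sigma> over arcs is at least
  the pairing 2, which \<rho> attains. The first variation towards \<sigma> is therefore
  nonnegative.\<close>

lemma gradient_optimal_density:
  assumes AB: "A \<subseteq> V" "B \<subseteq> V" "A \<noteq> {}" "A \<inter> B = {}" and "1 < p"
    and U: "is_potential A B U" and F: "is_unit_flow V E A B F"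
    and "0 < C" and FU: "\<And>x y. {x, y} \<in> E \<Longrightarrow> signed_powr (p - 1) (U y - U x) = C * F x y"
  shows "modulus E p (paths_between V E A B) = C"
    and "is_optimal_density E p (paths_between V E A B) (abs_on_edge (\<lambda>x y. U y - U x))"
proof -
  let ?P = "paths_between V E A B"
  define \<rho> where "\<rho> = abs_on_edge (\<lambda>x y. U y - U x)"
  have \<rho>: "\<rho> {x, y} = \<bar>U y - U x\<bar>" for x y
    unfolding \<rho>_def by (rule abs_on_edge_eq) simp
  have adm: "admissible E ?P \<rho>"
    unfolding \<rho>_def by (rule admissible_gradient[OF U])
  have pairing: "(\<Sum>(x, y) \<in> arcs E. F x y * (W y - W x)) = 2" if "is_potential A B W" for W
    using sum_unit_flow_gradient AB F that by blast
  have abs_powr: "\<bar>\<rho> {x, y}\<bar> powr p = C * (F x y * (U y - U x))" if "{x, y} \<in> E" for x y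
    using FU[OF that] signed_powr_mult_self[of p "U y - U x"] by (simp add: \<rho> mult_ac)
  \<comment> \<open>Taking absolute values in \<open>FU\<close> removes the sign, since \<rho> is
    nonnegative.\<close>
  have signed: "signed_powr (p - 1) (\<rho> {x, y}) = C * \<bar>F x y\<bar>" if "{x, y} \<in> E" for x y
    using arg_cong[OF FU[OF that], of abs] \<open>0 < C\<close>
    by (simp add: \<rho> abs_signed_powr abs_mult) (auto simp: signed_powr_def sgn_if)
  have sum_\<rho>: "(\<Sum>(x, y) \<in> arcs E. \<bar>\<rho> {x, y}\<bar> powr p) = 2 * C"
  proof -
    have "(\<Sum>(x, y) \<in> arcs E. \<bar>\<rho> {x, y}\<bar> powr p) = C * (\<Sum>(x, y) \<in> arcs E. F x y * (U y - U x))"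
      unfolding sum_distrib_left by (rule sum.cong) (auto simp: arcs_def abs_powr)
    with pairing[OF U] show ?thesis by simp
  qed
  \<comment> \<open>For admissible densities the absolute values change nothing; they give the mass
    the form required by the tangent criterion.\<close>
  have mass: "2 * density_mass E p \<sigma> = (\<Sum>(x, y) \<in> arcs E. \<bar>\<sigma> {x, y}\<bar> powr p)"
    if "admissible E ?P \<sigma>" for \<sigma>
  proof -
    have "2 * density_mass E p \<sigma> = (\<Sum>(x, y) \<in> arcs E. \<sigma> {x, y} powr p)"
      by (simp add: density_mass_def sum_arcs_eq_edges[of "\<lambda>e. \<sigma> e powr p"])
    also have "\<dots> = (\<Sum>(x, y) \<in> arcs E. \<bar>\<sigma> {x, y}\<bar> powr p)"
      by (rule sum.cong) (use that in \<open>auto simp: arcs_def admissible_def\<close>)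
    finally show ?thesis .
  qed
  have var: "0 \<le> (\<Sum>(x, y) \<in> arcs E. signed_powr (p - 1) (\<rho> {x, y}) * (\<sigma> {x, y} - \<rho> {x, y}))"
    if \<sigma>: "admissible E ?P \<sigma>" for \<sigma>
  proof -
    obtain W where W: "is_potential A B W"
      and dom: "\<And>x y. {x, y} \<in> E \<Longrightarrow> \<bar>W y - W x\<bar> \<le> \<sigma> {x, y}"
      using exists_dominated_potential[OF AB(1-3) \<sigma>] by blast
    have "F x y * (W y - W x) \<le> \<bar>F x y\<bar> * \<sigma> {x, y}" if "{x, y} \<in> E" for x y
    proof -
      have "F x y * (W y - W x) \<le> \<bar>F x y\<bar> * \<bar>W y - W x\<bar>"
        by (metis abs_ge_self abs_mult)
      also have "\<dots> \<le> \<bar>F x y\<bar> * \<sigma> {x, y}"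
        using dom[OF that] by (intro mult_left_mono) auto
      finally show ?thesis .
    qed
    then have ge: "2 \<le> (\<Sum>(x, y) \<in> arcs E. \<bar>F x y\<bar> * \<sigma> {x, y})"
      unfolding pairing[OF W, symmetric] by (intro sum_mono) (auto simp: arcs_def)
    have "(\<Sum>(x, y) \<in> arcs E. signed_powr (p - 1) (\<rho> {x, y}) * (\<sigma> {x, y} - \<rho> {x, y})) =
        (\<Sum>(x, y) \<in> arcs E. C * (\<bar>F x y\<bar> * \<sigma> {x, y}) - \<bar>\<rho> {x, y}\<bar> powr p)"
      by (rule sum.cong)
        (auto simp: arcs_def right_diff_distrib signed_powr_mult_self, simp add: signed)
    then have "(\<Sum>(x, y) \<in> arcs E. signed_powr (p - 1) (\<rho> {x, y}) * (\<sigma> {x, y} - \<rho> {x, y})) =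
        C * (\<Sum>(x, y) \<in> arcs E. \<bar>F x y\<bar> * \<sigma> {x, y}) - 2 * C"
      unfolding sum_\<rho>[symmetric] by (simp add: split_beta sum_subtractf sum_distrib_left)
    with ge show ?thesis using \<open>0 < C\<close> by simp
  qed
  have mass_\<rho>: "density_mass E p \<rho> = C"
    using mass[OF adm] sum_\<rho> by simp
  have le: "C \<le> density_mass E p \<sigma>" if "admissible E ?P \<sigma>" for \<sigma>
    using sum_powr_tangent_le[OF \<open>1 < p\<close>, of "\<lambda>(x, y). \<rho> {x, y}" "\<lambda>(x, y). \<sigma> {x, y}" "arcs E"]
      var[OF that] mass[OF that] sum_\<rho> by (simp add: split_beta)
  show mod: "modulus E p ?P = C"
    unfolding modulus_def
  proof (rule cInf_eq_minimum)
    show "C \<in> density_mass E p ` {\<rho>. admissible E ?P \<rho>}"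
      using adm mass_\<rho> by blast
  qed (use le in auto)
  show "is_optimal_density E p ?P (abs_on_edge (\<lambda>x y. U y - U x))"
    unfolding is_optimal_density_def \<rho>_def[symmetric] mod
  proof (intro conjI allI impI ballI adm mass_\<rho>)
    fix \<sigma> e assume \<sigma>: "admissible E ?P \<sigma> \<and> density_mass E p \<sigma> = C" and "e \<in> E"
    obtain x y where e: "e = {x, y}" using edge_as_pair[OF \<open>e \<in> E\<close>] by blast
    have "(\<Sum>(x, y) \<in> arcs E. \<bar>\<sigma> {x, y}\<bar> powr p) = (\<Sum>(x, y) \<in> arcs E. \<bar>\<rho> {x, y}\<bar> powr p)"
      using mass[of \<sigma>] sum_\<rho> \<sigma> by metis
    then have "\<forall>a \<in> arcs E. (case a of (x, y) \<Rightarrow> \<sigma> {x, y}) = (case a of (x, y) \<Rightarrow> \<rho> {x, y})"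
      using var[OF conjunct1[OF \<sigma>]] unfolding split_beta
      by (intro sum_powr_tangent_eqD[OF \<open>1 < p\<close> finite_arcs])
    then show "\<sigma> e = \<rho> e"
      using \<open>e \<in> E\<close> by (auto simp: arcs_def e)
  qed
qed

text \<open>Inverting \<open>FU\<close> with the dual exponent shows that the signed power of
  \<open>F\<close> is a multiple of the gradient of \<open>U\<close>. All unit flows pair equally
  with that gradient, so the first variation vanishes.\<close>

lemma gradient_minimal_unit_flow:
  assumes AB: "A \<subseteq> V" "B \<subseteq> V" "A \<inter> B = {}" and "1 < p"
    and U: "is_potential A B U" and F: "is_unit_flow V E A B F"
    and "0 < C" and FU: "\<And>x y. {x, y} \<in> E \<Longrightarrow> signed_powr (p - 1) (U y - U x) = C * F x y"
    and q: "q = dual_exponent p"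
  shows "minimal_unit_flow V E q A B = F"
    and "flow_energy E q F = C powr (1 - q)"
proof -
  have "1 < q" and q1: "(p - 1) * (q - 1) = 1"
    using \<open>1 < p\<close> by (auto simp: q dual_exponent_def field_simps)
  have anti: "\<forall>x y. G x y = - G y x" and null: "{x, y} \<notin> E \<Longrightarrow> G x y = 0"
    if "is_unit_flow V E A B G" for G x y
    using that unfolding is_unit_flow_def is_flow_def by blast+
  have pairing: "(\<Sum>(x, y) \<in> arcs E. G x y * (U y - U x)) = 2" if "is_unit_flow V E A B G" for G
    using sum_unit_flow_gradient AB U that by blast
  have signed: "signed_powr (q - 1) (F x y) = C powr (1 - q) * (U y - U x)" if "{x, y} \<in> E" for x y
  proof -
    have "signed_powr (q - 1) (C * F x y) = U y - U x"
      by (simp flip: FU[OF that] add: signed_powr_signed_powr q1 signed_powr_1)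
    moreover have "signed_powr (q - 1) C = C powr (q - 1)" "C powr (1 - q) * C powr (q - 1) = 1"
      using \<open>0 < C\<close> by (simp_all add: signed_powr_def flip: powr_add)
    ultimately show ?thesis
      by (metis mult.assoc mult_1 signed_powr_mult)
  qed
  have energy: "2 * flow_energy E q G = (\<Sum>(x, y) \<in> arcs E. \<bar>G x y\<bar> powr q)"
    if "is_unit_flow V E A B G" for G
    using flow_energy_eq_arcs anti that by blast
  have "(\<Sum>(x, y) \<in> arcs E. \<bar>F x y\<bar> powr q) =
      (\<Sum>(x, y) \<in> arcs E. C powr (1 - q) * (F x y * (U y - U x)))"
    by (rule sum.cong) (auto simp: arcs_def signed simp flip: signed_powr_mult_self)
  also have "\<dots> = C powr (1 - q) * 2"
    unfolding pairing[OF F, symmetric] by (simp add: split_beta sum_distrib_left)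
  finally show energy_F: "flow_energy E q F = C powr (1 - q)"
    using energy[OF F] by simp
  have var: "(\<Sum>(x, y) \<in> arcs E. signed_powr (q - 1) (F x y) * (G x y - F x y)) = 0"
    if G: "is_unit_flow V E A B G" for G
  proof -
    have "(\<Sum>(x, y) \<in> arcs E. signed_powr (q - 1) (F x y) * (G x y - F x y)) =
        (\<Sum>(x, y) \<in> arcs E. C powr (1 - q) * (G x y * (U y - U x)) -
          C powr (1 - q) * (F x y * (U y - U x)))"
      by (rule sum.cong) (auto simp: arcs_def signed algebra_simps)
    also have "\<dots> = C powr (1 - q) * 2 - C powr (1 - q) * 2"
      unfolding pairing[OF F, symmetric]
      by (subst pairing[OF F], subst pairing[OF G, symmetric])
        (simp add: split_beta sum_subtractf sum_distrib_left)
    finally show ?thesis by simp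
  qed
  have le: "flow_energy E q F \<le> flow_energy E q G" if "is_unit_flow V E A B G" for G
    using sum_powr_tangent_le[OF \<open>1 < q\<close>, of "\<lambda>(x, y). F x y" "\<lambda>(x, y). G x y" "arcs E"]
      var[OF that] energy[OF that] energy[OF F] by (simp add: split_beta)
  show "minimal_unit_flow V E q A B = F"
    unfolding minimal_unit_flow_def
  proof (rule the_equality)
    fix G assume G: "is_unit_flow V E A B G \<and>
      (\<forall>H. is_unit_flow V E A B H \<longrightarrow> flow_energy E q G \<le> flow_energy E q H)"
    then have unit: "is_unit_flow V E A B G" and "flow_energy E q G = flow_energy E q F"
      using F le by (auto intro: order_antisym)
    then have "(\<Sum>(x, y) \<in> arcs E. \<bar>G x y\<bar> powr q) = (\<Sum>(x, y) \<in> arcs E. \<bar>F x y\<bar> powr q)"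
      using energy F by metis
    then have "\<forall>a \<in> arcs E. (case a of (x, y) \<Rightarrow> G x y) = (case a of (x, y) \<Rightarrow> F x y)"
      using var[OF unit] unfolding split_beta
      by (intro sum_powr_tangent_eqD[OF \<open>1 < q\<close> finite_arcs]) simp_all
    \<comment> \<open>\<open>THE\<close> needs equality as functions on all pairs: off the edges
      both flows are 0.\<close>
    then have "G x y = F x y" for x y
      using null[OF F, of x y] null[OF unit, of x y]
      by (cases "{x, y} \<in> E") (auto simp: arcs_def)
    then show "G = F" by blast
  qed (use F le in blast)
qed

text \<open>One pair (U, F) solves both extremal problems with the same constant, so the minimal
  flow energy is a function of the modulus alone.\<close>

theorem flow_modulus_duality:
  assumes AB: "A \<subseteq> V" "B \<subseteq> V" "A \<noteq> {}" "B \<noteq> {}" "A \<inter> B = {}" and "1 < p"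
    and q: "q = dual_exponent p"
  shows "0 < modulus E p (paths_between V E A B)"
    and "flow_energy E q (minimal_unit_flow V E q A B) =
      modulus E p (paths_between V E A B) powr (1 - q)"
    and "\<exists>\<rho>. is_optimal_density E p (paths_between V E A B) \<rho>"
proof -
  obtain U :: "_ \<Rightarrow> real" and F where U: "is_potential A B U" and F: "is_unit_flow V E A B F"
    and C: "0 < gradient_energy E p U / 2"
    and FU: "\<And>x y. {x, y} \<in> E \<Longrightarrow> signed_powr (p - 1) (U y - U x) = gradient_energy E p U / 2 * F x y"
    using exists_potential_flow[OF AB \<open>1 < p\<close>] by (metis half_gt_zero)
  note density = gradient_optimal_density[OF AB(1-3,5) \<open>1 < p\<close> U F C FU]
  note flow = gradient_minimal_unit_flow[OF AB(1,2,5) \<open>1 < p\<close> U F C FU q]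
  show "0 < modulus E p (paths_between V E A B)"
    using density(1) C by simp
  show "flow_energy E q (minimal_unit_flow V E q A B) =
      modulus E p (paths_between V E A B) powr (1 - q)"
    by (simp only: density(1) flow)
  show "\<exists>\<rho>. is_optimal_density E p (paths_between V E A B) \<rho>"
    using density(2) by blast
qed

end

section \<open>Iterated graph systems\<close>

context iterated_graph_system
begin

lemma glue_set_subset: "{v, u} \<in> E \<Longrightarrow> glue_set I \<phi> v u \<subseteq> V"
  using phi_in_V by (simp add: glue_set_def)

lemma edge_flow_modulus_duality:
  assumes vu: "{v, u} \<in> E" and "1 < p" and q: "q = dual_exponent p"
  shows "0 < modulus E p (edge_paths V E I \<phi> v u)"
    and "flow_energy E q (edge_flow V E I \<phi> q v u) =
      modulus E p (edge_paths V E I \<phi> v u) powr (1 - q)"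
    and "\<exists>\<rho>. is_optimal_density E p (edge_paths V E I \<phi> v u) \<rho>"
proof -
  have "{u, v} \<in> E" using vu by (simp add: insert_commute)
  have nonempty: "glue_set I \<phi> x y \<noteq> {}" for x y
    using nonempty_I by (simp add: glue_set_def)
  note duality = flow_modulus_duality[OF glue_set_subset[OF vu] glue_set_subset[OF \<open>{u, v} \<in> E\<close>]
      nonempty nonempty glue_disjoint[OF vu] \<open>1 < p\<close> q, folded edge_paths_def edge_flow_def]
  show "0 < modulus E p (edge_paths V E I \<phi> v u)"
    by (rule duality)
  show "flow_energy E q (edge_flow V E I \<phi> q v u) =
      modulus E p (edge_paths V E I \<phi> v u) powr (1 - q)"
    by (rule duality)
  show "\<exists>\<rho>. is_optimal_density E p (edge_paths V E I \<phi> v u) \<rho>"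
    by (rule duality)
qed

text \<open>Since q differs from 1, the map from M to M^(1-q) is injective on positive reals, so
  equal flow energies on two edges force equal moduli.\<close>

lemma modulus_eq_igs_modulus:
  assumes cond: "conductively_uniform V E I \<phi>" and "1 < p" and vu: "{v, u} \<in> E"
  shows "modulus E p (edge_paths V E I \<phi> v u) = igs_modulus V E I \<phi> p"
proof -
  define q where "q = dual_exponent p"
  have "q \<noteq> 1" using \<open>1 < p\<close> by (simp add: q_def dual_exponent_def field_simps)
  have "modulus E p (edge_paths V E I \<phi> v' u') = modulus E p (edge_paths V E I \<phi> v u)"
    if vu': "{v', u'} \<in> E" for v' u'
  proof -
    have "flow_energy E q (edge_flow V E I \<phi> q v' u') = flow_energy E q (edge_flow V E I \<phi> q v u)"
      using cond \<open>1 < p\<close> vu vu' nonempty_I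
      unfolding conductively_uniform_def Let_def q_def by blast
    then have "modulus E p (edge_paths V E I \<phi> v' u') powr (1 - q) =
        modulus E p (edge_paths V E I \<phi> v u) powr (1 - q)"
      using edge_flow_modulus_duality(2)[OF vu \<open>1 < p\<close> q_def]
        edge_flow_modulus_duality(2)[OF vu' \<open>1 < p\<close> q_def]
      by simp
    then have "(1 - q) * ln (modulus E p (edge_paths V E I \<phi> v' u')) =
        (1 - q) * ln (modulus E p (edge_paths V E I \<phi> v u))"
      by (metis ln_powr)
    then show ?thesis
      using edge_flow_modulus_duality(1)[OF vu \<open>1 < p\<close> q_def]
        edge_flow_modulus_duality(1)[OF vu' \<open>1 < p\<close> q_def]
        \<open>q \<noteq> 1\<close> by simp
  qed
  then show ?thesis
    unfolding igs_modulus_def by (intro the_equality[symmetric]) (use vu in blast)+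
qed

text \<open>A path with n edges between the two glue sets bounds the distance of its endpoints,
  which is \<open>L\<close>, by n; hence n / L \<ge> 1.\<close>

lemma uniform_density_admissible:
  assumes L: "0 < L" and scaling: "uniform_scaling V E I \<phi> L" and vu: "{v, u} \<in> E"
  shows "admissible E (edge_paths V E I \<phi> v u) (\<lambda>_. inverse (real L))"
  unfolding admissible_def
proof (intro conjI ballI)
  fix vs assume vs: "vs \<in> edge_paths V E I \<phi> v u"
  then have "vs \<noteq> []" by (auto simp: edge_paths_def paths_between_def is_path_def)
  then obtain n where n: "length vs = Suc n" by (cases vs) auto
  have "vs \<in> paths_between V E {hd vs} {last vs}"
    using vs by (auto simp: edge_paths_def paths_between_def)
  then have "graph_dist V E (hd vs) (last vs) \<le> n"
    unfolding graph_dist_def using n by (intro Least_le) blast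
  moreover have "graph_dist V E (hd vs) (last vs) = L"
    using scaling vs vu by (auto simp: uniform_scaling_def edge_paths_def paths_between_def)
  ultimately show "1 \<le> (\<Sum>i < length vs - 1. inverse (real L))"
    using n L by (simp add: field_simps)
qed simp

end

text \<open>Minimal mass makes \<sigma> agree on \<open>E\<close> with the unique minimizer \<rho>,
  and \<sigma> then inherits the uniqueness.\<close>

lemma is_optimal_density_iff_mass:
  assumes "is_optimal_density E p \<Theta> \<rho>" "admissible E \<Theta> \<sigma>"
  shows "is_optimal_density E p \<Theta> \<sigma> \<longleftrightarrow> density_mass E p \<sigma> = modulus E p \<Theta>"
  using assms unfolding is_optimal_density_def by metis

theorem proposition6p10:
  fixes V :: "'v set" and E :: "'v set set" and I :: "'i set"
    and \<phi> :: "'v \<Rightarrow> 'v set \<Rightarrow> 'i \<Rightarrow> 'v"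
    and L :: nat and p :: real
  assumes "iterated_graph_system V E I \<phi>"
    and "1 < p"
    and "2 \<le> L"
    and "uniform_scaling V E I \<phi> L"
    and "doubling E I \<phi>"
    and "conductively_uniform V E I \<phi>"
  shows "p \<le> walk_dimension V E I \<phi> L p \<and>
    (walk_dimension V E I \<phi> L p = p \<longleftrightarrow>
      (\<forall>v u. {v, u} \<in> E \<longrightarrow>
        is_optimal_density E p (edge_paths V E I \<phi> v u) (\<lambda>_. inverse (real L))))"
proof -
  interpret iterated_graph_system V E I \<phi> by fact
  define M where "M = igs_modulus V E I \<phi> p"
  define m where "m = density_mass E p (\<lambda>_. inverse (real L))"
  have m: "m = card E * inverse (L powr p)"
    using \<open>2 \<le> L\<close> by (simp add: m_def density_mass_def inverse_powr)
  have modulus: "modulus E p (edge_paths V E I \<phi> v u) = M" if "{v, u} \<in> E" for v u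
    unfolding M_def by (rule modulus_eq_igs_modulus) fact+
  \<comment> \<open>The condition \<open>m = M\<close> does not mention the edge, so the constant
    density is optimal for all edges or for none.\<close>
  have optimal: "is_optimal_density E p (edge_paths V E I \<phi> v u) (\<lambda>_. inverse (real L)) \<longleftrightarrow> m = M"
    and M: "0 < M" "M \<le> m" if vu: "{v, u} \<in> E" for v u
  proof -
    have adm: "admissible E (edge_paths V E I \<phi> v u) (\<lambda>_. inverse (real L))"
      using uniform_density_admissible[OF _ \<open>uniform_scaling V E I \<phi> L\<close> vu] \<open>2 \<le> L\<close> by simp
    obtain \<rho> where "is_optimal_density E p (edge_paths V E I \<phi> v u) \<rho>"
      using edge_flow_modulus_duality(3)[OF vu \<open>1 < p\<close> refl] by blast
    from is_optimal_density_iff_mass[OF this adm]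
    show "is_optimal_density E p (edge_paths V E I \<phi> v u) (\<lambda>_. inverse (real L)) \<longleftrightarrow> m = M"
      by (simp add: modulus[OF vu] m_def)
    show "0 < M"
      using edge_flow_modulus_duality(1)[OF vu \<open>1 < p\<close> refl] by (simp add: modulus[OF vu])
    have "bdd_below (density_mass E p ` {\<rho>. admissible E (edge_paths V E I \<phi> v u) \<rho>})"
      by (rule bdd_belowI2[of _ 0]) (simp add: density_mass_def sum_nonneg)
    then show "M \<le> m"
      unfolding modulus[OF vu, symmetric] modulus_def m_def using adm by (intro cINF_lower) auto
  qed
  obtain v u where vu: "{v, u} \<in> E"
    using edge_exists edge_as_pair by blast
  note M = M[OF vu]
  have "0 < card E" using edge_exists finite_edges by (simp add: card_gt_0_iff)
  have "0 < m" using M by linarith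
  \<comment> \<open>Factoring out L^p splits the walk dimension into \<open>p\<close> and the excess
    ln (m / M) / ln L.\<close>
  have "real (card E) * inverse M = L powr p * (m / M)"
    using M(1) \<open>2 \<le> L\<close> by (simp add: m field_simps)
  moreover have "ln (L powr p * (m / M)) = ln (L powr p) + ln (m / M)"
    using M(1) \<open>0 < m\<close> \<open>2 \<le> L\<close> by (intro ln_mult_pos) auto
  ultimately have "ln (real (card E) * inverse M) = p * ln L + ln (m / M)"
    by (simp add: ln_powr)
  then have dim: "walk_dimension V E I \<phi> L p = p + ln (m / M) / ln L"
    using \<open>2 \<le> L\<close> by (simp add: walk_dimension_def M_def[symmetric] add_divide_distrib)
  have "0 < ln (real L)" using \<open>2 \<le> L\<close> by simp
  moreover have "0 \<le> ln (m / M)" "ln (m / M) = 0 \<longleftrightarrow> m = M"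
    using M \<open>0 < m\<close> by (auto simp: ln_ge_zero_iff)
  ultimately show ?thesis
    using optimal vu by (auto simp: dim)
qed

end
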